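(* Let $(C,\phi,F)$ be a semicoherent $n$-component system with $C=\{1,\ldots,n\}$ whose component lifetimes $T_1,\ldots,T_n$ have no ties. For every nonempty set $M\subseteq C$ with $m=|M|$ and every $k\in\{1,\ldots,m\}$, the probability $p_M^{(k)}=\Pr(T_C=T_{k:M})$ satisfies $$ p_M^{(k)} = \sum_{A\subseteq C,\ |M\setminus A|=k}\ \sum_{j\in M\setminus A} q_j(A)\,\Delta_j\phi(A) = \sum_{j\in M}\ \sum_{A\subseteq C\setminus\{j\},\ |M\setminus A|=k} q_j(A)\,\Delta_j\phi(A). $$
   Context: $C=\{1,\ldots,n\}$ is the set of components. $T_1,\ldots,T_n$ are nonnegative real random variables on a common probability space (the component lifetimes), with joint c.d.f. $F$, and there are no ties: $\Pr(T_i=T_j)=0$ for all distinct $i,j\in C$. No independence is assumed. The structure function $\phi\colon\{0,1\}^n\to\{0,1\}$ is identified with a set function $\phi\colon 2^C\to\{0,1\}$ (identify $(x_1,\ldots,x_n)$ with $A=\{i: x_i=1\}$). The system is semicoherent: $\phi$ is nondecreasing in each variable, $\phi(\varnothing)=0$ and $\phi(C)=1$. The system lifetime is $T_C=\max_{A\subseteq C,\ \phi(A)=1}\min_{i\in A}T_i$. For nonempty $M\subseteq C$ with $m=|M|$, $T_{k:M}$ is the $k$th smallest of the variables $T_i$, $i\in M$ ($k$th order statistic). For $j\in C$ and $A\subseteq C\setminus\{j\}$: $\Delta_j\phi(A)=\phi(A\cup\{j\})-\phi(A)$ and $q_j(A)=\Pr\big(\max_{i\in C\setminus A}T_i=T_j<\min_{i\in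 A}T_i\big)$. The minimum over the empty set is $+\infty$. *)

theory Defs
  imports "HOL-Probability.Probability"
begin

(* The structure function is a set function with values in {0,1}; only its values on
   subsets of C are constrained. *)
definition semicoherent :: "'i set \<Rightarrow> ('i set \<Rightarrow> real) \<Rightarrow> bool" where
  "semicoherent C \<phi> \<longleftrightarrow>
     (\<forall>A\<subseteq>C. \<phi> A \<in> {0, 1}) \<and>
     (\<forall>j\<in>C. \<forall>A\<subseteq>C - {j}. \<phi> A \<le> \<phi> (A \<union> {j})) \<and>
     \<phi> {} = 0 \<and> \<phi> C = 1"

(* For semicoherent phi and finite C, the outer Max ranges over a nonempty finite set and
   every A involved is nonempty. *)
definition system_lifetime ::
    "'i set \<Rightarrow> ('i set \<Rightarrow> real) \<Rightarrow> ('i \<Rightarrow> 'a \<Rightarrow> real) \<Rightarrow> 'a \<Rightarrow> real" where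
  "system_lifetime C \<phi> T \<omega> =
     Max ((\<lambda>A. Min ((\<lambda>i. T i \<omega>) ` A)) ` {A. A \<subseteq> C \<and> \<phi> A = 1})"

(* k-th smallest value, counted with multiplicity; list indices start at 0, so k = 1 is
   the minimum. Meaningful for finite M and 1 \<le> k \<le> card M. *)
definition order_stat :: "('i \<Rightarrow> 'a \<Rightarrow> real) \<Rightarrow> 'i set \<Rightarrow> nat \<Rightarrow> 'a \<Rightarrow> real" where
  "order_stat T M k \<omega> =
     sorted_list_of_multiset (image_mset (\<lambda>i. T i \<omega>) (mset_set M)) ! (k - 1)"

definition Delta :: "'i \<Rightarrow> ('i set \<Rightarrow> real) \<Rightarrow> 'i set \<Rightarrow> real" where
  "Delta j \<phi> A = \<phi> (A \<union> {j}) - \<phi> A"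

(* The infimum is taken in ereal, so that the minimum over the empty set is infinity. *)
definition rel_quality ::
    "'a measure \<Rightarrow> 'i set \<Rightarrow> ('i \<Rightarrow> 'a \<Rightarrow> real) \<Rightarrow> 'i \<Rightarrow> 'i set \<Rightarrow> real" where
  "rel_quality P C T j A =
     measure P {\<omega> \<in> space P. Max ((\<lambda>i. T i \<omega>) ` (C - A)) = T j \<omega> \<and>
                              ereal (T j \<omega>) < (INF i\<in>A. ereal (T i \<omega>))}"

end

theory Submission
  imports Defs
begin

text \<open>
Fix an outcome without ties and write \<open>t i\<close> for the lifetime of component
\<open>i\<close>. When component \<open>j\<close> fails, the set of survivors is \<open>A\<^sub>j = {i \<in> C. t j < t i}\<close>, and the system
fails at that very moment iff \<open>j\<close> is pivotal for \<open>A\<^sub>j\<close>, that is, \<open>\<phi> (A\<^sub>j \<union> {j}) = 1\<close> and \<open>\<phi> A\<^sub>j = 0\<close>.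
Likewise \<open>t j\<close> is the \<open>k\<close>-th smallest lifetime in \<open>M\<close> iff exactly \<open>k\<close> members of \<open>M\<close> are no longer
among the survivors, that is, \<open>card (M - A\<^sub>j) = k\<close>. There is exactly one such \<open>j \<in> M\<close>, so the indicator
of the event in question is the sum, over \<open>j \<in> M\<close> and sets \<open>A\<close> with \<open>card (M - A) = k\<close>, of
\<open>Delta j \<phi> A\<close> times the indicator of \<open>A = A\<^sub>j\<close>. The event \<open>A = A\<^sub>j\<close> is the one whose probability is
the relative quality of \<open>j\<close> and \<open>A\<close>, so taking expectations gives the claim.

Both comparisons come from descriptions by level sets: the system outlives \<open>x\<close> iff the components
that outlive \<open>x\<close> form a working set (\<open>system_lifetime_ge_iff\<close>, \<open>system_lifetime_gt_iff\<close>), and the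
\<open>k\<close>-th order statistic lies in a down-closed set iff at least \<open>k\<close> of the values do
(\<open>order_stat_down_closed_iff\<close>). The outcomes with ties have probability zero and do not affect the
expectation.
\<close>

section \<open>Order statistics\<close>

text \<open>The elements of a sorted list that satisfy a down-closed predicate form a prefix of it, and an
index belongs to a prefix iff it is smaller than the length.\<close>

lemma sorted_nth_down_closed_iff:
  fixes xs :: "'b::linorder list"
  assumes "sorted xs" "k < length xs" and down: "\<And>x y. x \<le> y \<Longrightarrow> Q y \<Longrightarrow> Q x"
  shows "Q (xs ! k) \<longleftrightarrow> k < length (filter Q xs)"
  using assms(1,2)
proof (induction xs arbitrary: k)
  case (Cons a xs)
  show ?case
  proof (cases "Q a")
    case True
    then show ?thesis using Cons by (cases k) auto
  next
    case False
    then have "\<not> Q y" if "y \<in> set (a # xs)" for y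
      using that Cons.prems(1) down by auto
    then show ?thesis using Cons.prems(2) nth_mem[of k "a # xs"]
      by (metis filter_False length_0_conv not_less_zero)
  qed
qed simp

lemma order_stat_down_closed_iff:
  assumes "finite M" "k \<in> {1..card M}" and down: "\<And>x y. x \<le> y \<Longrightarrow> Q y \<Longrightarrow> Q x"
  shows "Q (order_stat T M k \<omega>) \<longleftrightarrow> k \<le> card {i \<in> M. Q (T i \<omega>)}"
proof -
  let ?xs = "sorted_list_of_multiset (image_mset (\<lambda>i. T i \<omega>) (mset_set M))"
  have "length ?xs = card M"
    by (metis mset_sorted_list_of_multiset size_image_mset size_mset size_mset_set)
  moreover have "length (filter Q ?xs) = card {i \<in> M. Q (T i \<omega>)}"
  proof -
    have "length (filter Q ?xs) = size (filter_mset Q (mset ?xs))"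
      by (metis mset_filter size_mset)
    also have "\<dots> = card {i \<in> M. Q (T i \<omega>)}"
      using assms(1) by (simp add: filter_mset_image_mset)
    finally show ?thesis .
  qed
  moreover have "Q (?xs ! (k - 1)) \<longleftrightarrow> k - 1 < length (filter Q ?xs)"
    using assms(2) calculation(1) by (intro sorted_nth_down_closed_iff) (auto intro: down)
  ultimately show ?thesis
    using assms(2) by (auto simp: order_stat_def)
qed

lemma order_stat_in_image:
  assumes "finite M" "k \<in> {1..card M}"
  shows "order_stat T M k \<omega> \<in> (\<lambda>i. T i \<omega>) ` M"
proof -
  let ?xs = "sorted_list_of_multiset (image_mset (\<lambda>i. T i \<omega>) (mset_set M))"
  have "length ?xs = card M"
    by (metis mset_sorted_list_of_multiset size_image_mset size_mset size_mset_set)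
  then have "?xs ! (k - 1) \<in> set ?xs"
    using assms(2) by (intro nth_mem) auto
  then show ?thesis
    using assms(1) by (simp add: order_stat_def)
qed

text \<open>Without ties, the count of values up to \<open>T j \<omega>\<close> exceeds the count of values strictly below it by
exactly one. So the two level set conditions pin down the rank of \<open>j\<close>.\<close>

lemma order_stat_eq_iff_rank:
  assumes "finite M" "k \<in> {1..card M}" "inj_on (\<lambda>i. T i \<omega>) M" "j \<in> M"
  shows "order_stat T M k \<omega> = T j \<omega> \<longleftrightarrow> card {i \<in> M. T i \<omega> \<le> T j \<omega>} = k"
proof -
  have "T i \<omega> = T j \<omega> \<longleftrightarrow> i = j" if "i \<in> M" for i
    using inj_on_eq_iff[OF assms(3) that assms(4)] .
  then have "{i \<in> M. T i \<omega> \<le> T j \<omega>} = insert j {i \<in> M. T i \<omega> < T j \<omega>}"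
    using assms(4) by (auto simp: order_le_less)
  then have "card {i \<in> M. T i \<omega> \<le> T j \<omega>} = Suc (card {i \<in> M. T i \<omega> < T j \<omega>})"
    using assms(1) by simp
  moreover have "order_stat T M k \<omega> \<le> T j \<omega> \<longleftrightarrow> k \<le> card {i \<in> M. T i \<omega> \<le> T j \<omega>}"
    using order_stat_down_closed_iff[OF assms(1,2), of "\<lambda>x. x \<le> T j \<omega>"] by simp
  moreover have "order_stat T M k \<omega> < T j \<omega> \<longleftrightarrow> k \<le> card {i \<in> M. T i \<omega> < T j \<omega>}"
    using order_stat_down_closed_iff[OF assms(1,2), of "\<lambda>x. x < T j \<omega>"] by simp
  ultimately show ?thesis by linarith
qed

text \<open>Sublevel sets of the order statistic are given by counting, hence measurable.\<close>

lemma borel_measurable_order_stat: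
  assumes "finite M" "k \<in> {1..card M}" "\<And>i. i \<in> M \<Longrightarrow> T i \<in> borel_measurable P"
  shows "order_stat T M k \<in> borel_measurable P"
proof (rule borel_measurable_iff_le[THEN iffD2], intro allI)
  fix x :: real
  have "(\<Sum>i\<in>M. indicat_real {..x} (T i \<omega>)) = card {i \<in> M. T i \<omega> \<le> x}" for \<omega>
    using assms(1) by (simp add: indicator_def Int_def flip: sum.inter_filter)
  then have "{\<omega> \<in> space P. order_stat T M k \<omega> \<le> x}
      = {\<omega> \<in> space P. real k \<le> (\<Sum>i\<in>M. indicat_real {..x} (T i \<omega>))}"
    using order_stat_down_closed_iff[where T = T, OF assms(1,2), of "\<lambda>y. y \<le> x"]
    by simp
  moreover have "\<dots> \<in> sets P"
    using assms(3) by measurable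
  ultimately show "{\<omega> \<in> space P. order_stat T M k \<omega> \<le> x} \<in> sets P" by simp
qed

section \<open>The lifetime of a semicoherent system\<close>

lemma semicoherent_mono:
  assumes "semicoherent C \<phi>" "finite C" "A \<subseteq> B" "B \<subseteq> C"
  shows "\<phi> A \<le> \<phi> B"
proof -
  have "F \<subseteq> C \<Longrightarrow> \<phi> A \<le> \<phi> (A \<union> F)" if "finite F" "F \<inter> A = {}" for F
    using that
  proof (induction F rule: finite_induct)
    case (insert x F)
    then have "x \<in> C" "A \<union> F \<subseteq> C - {x}"
      using assms(3,4) by auto
    then have "\<phi> (A \<union> F) \<le> \<phi> (A \<union> F \<union> {x})"
      using assms(1) by (simp add: semicoherent_def)
    then show ?case using insert.IH insert.prems by simp
  qed simp
  from this[of "B - A"] show ?thesis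
    using assms by (auto simp: Un_absorb1 intro: finite_subset)
qed

lemma semicoherent_zero_or_one:
  assumes "semicoherent C \<phi>" "A \<subseteq> C"
  shows "\<phi> A = 0 \<or> \<phi> A = 1"
  using assms unfolding semicoherent_def by blast

text \<open>By monotonicity, the largest set of components satisfying \<open>Q\<close> decides for all smaller ones. With
\<open>Q\<close> a lower bound on the lifetimes, this turns the max-min formula for the system lifetime into level
set conditions.\<close>

lemma semicoherent_ex_working_iff:
  assumes "semicoherent C \<phi>" "finite C"
  shows "(\<exists>A\<subseteq>C. \<phi> A = 1 \<and> (\<forall>i\<in>A. Q i)) \<longleftrightarrow> \<phi> {i \<in> C. Q i} = 1"
proof
  assume "\<exists>A\<subseteq>C. \<phi> A = 1 \<and> (\<forall>i\<in>A. Q i)"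
  then obtain A where A: "A \<subseteq> C" "\<phi> A = 1" "\<forall>i\<in>A. Q i" by blast
  then have "\<phi> A \<le> \<phi> {i \<in> C. Q i}"
    by (intro semicoherent_mono[OF assms]) auto
  then show "\<phi> {i \<in> C. Q i} = 1"
    using A(2) semicoherent_zero_or_one[OF assms(1), of "{i \<in> C. Q i}"] by auto
next
  assume "\<phi> {i \<in> C. Q i} = 1"
  then show "\<exists>A\<subseteq>C. \<phi> A = 1 \<and> (\<forall>i\<in>A. Q i)"
    by (intro exI[of _ "{i \<in> C. Q i}"]) auto
qed

lemma working_sets_nonempty: "semicoherent C \<phi> \<Longrightarrow> {A. A \<subseteq> C \<and> \<phi> A = 1} \<noteq> {}"
  by (auto simp: semicoherent_def)

lemma working_set_finite_nonempty:
  assumes "semicoherent C \<phi>" "finite C" "A \<subseteq> C" "\<phi> A = 1"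
  shows "finite A" "A \<noteq> {}"
  using assms by (auto simp: semicoherent_def dest: finite_subset)

lemma system_lifetime_ge_iff:
  assumes "semicoherent C \<phi>" "finite C"
  shows "x \<le> system_lifetime C \<phi> T \<omega> \<longleftrightarrow> \<phi> {i \<in> C. x \<le> T i \<omega>} = 1"
proof -
  have "x \<le> system_lifetime C \<phi> T \<omega>
      \<longleftrightarrow> (\<exists>A\<subseteq>C. \<phi> A = 1 \<and> x \<le> Min ((\<lambda>i. T i \<omega>) ` A))"
    using assms(2) working_sets_nonempty[OF assms(1)]
    by (auto simp: system_lifetime_def Max_ge_iff)
  also have "\<dots> \<longleftrightarrow> (\<exists>A\<subseteq>C. \<phi> A = 1 \<and> (\<forall>i\<in>A. x \<le> T i \<omega>))"
    using working_set_finite_nonempty[OF assms] by (intro ex_cong1 conj_cong refl) auto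
  finally show ?thesis
    using semicoherent_ex_working_iff[OF assms] by simp
qed

lemma system_lifetime_gt_iff:
  assumes "semicoherent C \<phi>" "finite C"
  shows "x < system_lifetime C \<phi> T \<omega> \<longleftrightarrow> \<phi> {i \<in> C. x < T i \<omega>} = 1"
proof -
  have "x < system_lifetime C \<phi> T \<omega>
      \<longleftrightarrow> (\<exists>A\<subseteq>C. \<phi> A = 1 \<and> x < Min ((\<lambda>i. T i \<omega>) ` A))"
    using assms(2) working_sets_nonempty[OF assms(1)]
    by (auto simp: system_lifetime_def Max_gr_iff)
  also have "\<dots> \<longleftrightarrow> (\<exists>A\<subseteq>C. \<phi> A = 1 \<and> (\<forall>i\<in>A. x < T i \<omega>))"
    using working_set_finite_nonempty[OF assms] by (intro ex_cong1 conj_cong refl) auto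
  finally show ?thesis
    using semicoherent_ex_working_iff[OF assms] by simp
qed

text \<open>The system fails together with \<open>j\<close> iff it still works with the components \<open>A \<union> {j}\<close> that last at
least until then, but not with the strict survivors \<open>A\<close>. As \<open>\<phi>\<close> is monotone with values 0 and 1, the
difference \<open>Delta j \<phi> A\<close> is the indicator of this event.\<close>

lemma Delta_survivors:
  assumes "semicoherent C \<phi>" "finite C" "inj_on (\<lambda>i. T i \<omega>) C" "j \<in> C"
  shows "Delta j \<phi> {i \<in> C. T j \<omega> < T i \<omega>} = of_bool (system_lifetime C \<phi> T \<omega> = T j \<omega>)"
proof -
  let ?A = "{i \<in> C. T j \<omega> < T i \<omega>}"
  have "T j \<omega> = T i \<omega> \<longleftrightarrow> j = i" if "i \<in> C" for i
    using inj_on_eq_iff[OF assms(3) assms(4) that] .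
  then have ge: "{i \<in> C. T j \<omega> \<le> T i \<omega>} = ?A \<union> {j}"
    using assms(4) by (auto simp: order_le_less)
  have sub: "?A \<subseteq> C" "?A \<union> {j} \<subseteq> C" using assms(4) by auto
  have "T j \<omega> \<le> system_lifetime C \<phi> T \<omega> \<longleftrightarrow> \<phi> (?A \<union> {j}) = 1"
    using system_lifetime_ge_iff[OF assms(1,2)] ge by metis
  moreover have "T j \<omega> < system_lifetime C \<phi> T \<omega> \<longleftrightarrow> \<phi> ?A = 1"
    by (rule system_lifetime_gt_iff[OF assms(1,2)])
  moreover have "\<phi> ?A \<le> \<phi> (?A \<union> {j})"
    using sub(2) by (intro semicoherent_mono[OF assms(1,2)]) auto
  ultimately show ?thesis
    using semicoherent_zero_or_one[OF assms(1) sub(1)] semicoherent_zero_or_one[OF assms(1) sub(2)]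
    unfolding Delta_def by auto
qed

lemma borel_measurable_system_lifetime:
  assumes "semicoherent C \<phi>" "finite C" "\<And>i. i \<in> C \<Longrightarrow> T i \<in> borel_measurable P"
  shows "system_lifetime C \<phi> T \<in> borel_measurable P"
  unfolding system_lifetime_def
proof (rule borel_measurable_Max)
  show "finite {A. A \<subseteq> C \<and> \<phi> A = 1}" using assms(2) by simp
next
  fix A assume "A \<in> {A. A \<subseteq> C \<and> \<phi> A = 1}"
  then show "(\<lambda>\<omega>. Min ((\<lambda>i. T i \<omega>) ` A)) \<in> borel_measurable P"
    using working_set_finite_nonempty[OF assms(1,2), of A] assms(3) by (intro borel_measurable_Min) auto
qed

section \<open>Relative quality and the signature formula\<close>

text \<open>The first condition says that no component outside \<open>A\<close> survives \<open>j\<close>, the second that all components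
in \<open>A\<close> do. An infimum over the empty set is infinite, so the case \<open>A = {}\<close> fits in.\<close>

lemma rel_quality_event_iff:
  fixes t :: "'i \<Rightarrow> real"
  assumes "finite C" "A \<subseteq> C" "j \<in> C - A"
  shows "Max (t ` (C - A)) = t j \<and> ereal (t j) < (INF i\<in>A. ereal (t i))
           \<longleftrightarrow> A = {i \<in> C. t j < t i}"
proof -
  have "Max (t ` (C - A)) = t j \<longleftrightarrow> (\<forall>i\<in>C - A. t i \<le> t j)"
    using assms(1,3) by (subst Max_eq_iff) auto
  moreover have "ereal (t j) < (INF i\<in>A. ereal (t i)) \<longleftrightarrow> (\<forall>i\<in>A. t j < t i)"
  proof (cases "A = {}")
    case False
    have "finite A" using assms by (auto intro: finite_subset)
    with False have "(INF i\<in>A. ereal (t i)) = Min ((\<lambda>i. ereal (t i)) ` A)"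
      by (simp add: Min_Inf)
    then show ?thesis
      using False \<open>finite A\<close> by simp
  qed (simp add: top_ereal_def)
  ultimately show ?thesis
    using assms(2) unfolding not_less[symmetric] by blast
qed

lemma rel_quality_eq_measure_survivors:
  assumes "finite C" "A \<subseteq> C" "j \<in> C - A"
  shows "rel_quality P C T j A = measure P {\<omega> \<in> space P. A = {i \<in> C. T j \<omega> < T i \<omega>}}"
  unfolding rel_quality_def using rel_quality_event_iff[OF assms, where t = "\<lambda>i. T i _"]
  by simp

lemma sets_survivors_eq:
  fixes T :: "'i \<Rightarrow> 'a \<Rightarrow> real"
  assumes "finite C" "A \<subseteq> C" "\<And>i. i \<in> C \<Longrightarrow> T i \<in> borel_measurable P" "j \<in> C"
  shows "{\<omega> \<in> space P. A = {i \<in> C. T j \<omega> < T i \<omega>}} \<in> sets P"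
proof -
  have "{\<omega> \<in> space P. A = {i \<in> C. T j \<omega> < T i \<omega>}}
      = {\<omega> \<in> space P. \<forall>i\<in>C. i \<in> A \<longleftrightarrow> T j \<omega> < T i \<omega>}"
    using assms(2) by auto
  moreover have "\<dots> \<in> sets P"
    using assms(1,3,4) by measurable
  ultimately show ?thesis by simp
qed

text \<open>Only the component \<open>j\<close> of rank \<open>k\<close> in \<open>M\<close>, paired with the set of its survivors, contributes to
the double sum.\<close>

lemma indicator_lifetime_eq_order_stat:
  assumes "semicoherent C \<phi>" "finite C" "M \<subseteq> C" "k \<in> {1..card M}"
    and inj: "inj_on (\<lambda>i. T i \<omega>) C"
  shows "of_bool (system_lifetime C \<phi> T \<omega> = order_stat T M k \<omega>)
       = (\<Sum>j\<in>M. \<Sum>A | A \<subseteq> C - {j} \<and> card (M - A) = k.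
            of_bool (A = {i \<in> C. T j \<omega> < T i \<omega>}) * Delta j \<phi> A)"
proof -
  have finM: "finite M" and injM: "inj_on (\<lambda>i. T i \<omega>) M"
    using assms by (auto intro: finite_subset inj_on_subset)
  let ?A = "\<lambda>j. {i \<in> C. T j \<omega> < T i \<omega>}"
  have inner: "(\<Sum>A | A \<subseteq> C - {j} \<and> card (M - A) = k. of_bool (A = ?A j) * Delta j \<phi> A)
      = of_bool (order_stat T M k \<omega> = T j \<omega>) * Delta j \<phi> (?A j)" if "j \<in> M" for j
  proof -
    have "M - ?A j = {i \<in> M. T i \<omega> \<le> T j \<omega>}" "?A j \<subseteq> C - {j}"
      using assms(3) by (auto simp: not_less)
    then have "?A j \<in> {A. A \<subseteq> C - {j} \<and> card (M - A) = k} \<longleftrightarrow> order_stat T M k \<omega> = T j \<omega>"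
      using order_stat_eq_iff_rank[where T = T, OF finM assms(4) injM that] by simp
    moreover have "finite {A. A \<subseteq> C - {j} \<and> card (M - A) = k}"
      using assms(2) by simp
    then have "(\<Sum>A | A \<subseteq> C - {j} \<and> card (M - A) = k. if A = ?A j then Delta j \<phi> A else 0)
        = (if ?A j \<in> {A. A \<subseteq> C - {j} \<and> card (M - A) = k} then Delta j \<phi> (?A j) else 0)"
      by (rule sum.delta)
    ultimately show ?thesis
      by (simp add: of_bool_def if_distrib[of "\<lambda>x. x * _"] cong: if_cong)
  qed
  \<comment> \<open>Without ties, exactly one \<open>j0 \<in> M\<close> attains the order statistic.\<close>
  obtain j0 where j0: "j0 \<in> M" "order_stat T M k \<omega> = T j0 \<omega>"
    using order_stat_in_image[OF finM assms(4)] by (metis imageE)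
  have "of_bool (order_stat T M k \<omega> = T j \<omega>) * Delta j \<phi> (?A j)
      = (if j = j0 then Delta j \<phi> (?A j) else 0)" if "j \<in> M" for j
    using inj_onD[OF injM] j0 that by auto
  then have "(\<Sum>j\<in>M. of_bool (order_stat T M k \<omega> = T j \<omega>) * Delta j \<phi> (?A j))
      = Delta j0 \<phi> (?A j0)"
    using finM j0(1) by simp
  also have "\<dots> = of_bool (system_lifetime C \<phi> T \<omega> = order_stat T M k \<omega>)"
    using Delta_survivors[where T = T, OF assms(1,2) inj] assms(3) j0 by auto
  finally show ?thesis
    using inner by simp
qed

lemma AE_inj_on_of_no_ties:
  fixes T :: "'i \<Rightarrow> 'a \<Rightarrow> real"
  assumes "prob_space P" "finite C" "\<And>i. i \<in> C \<Longrightarrow> T i \<in> borel_measurable P"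
    and "\<And>i j. i \<in> C \<Longrightarrow> j \<in> C \<Longrightarrow> i \<noteq> j \<Longrightarrow> measure P {\<omega> \<in> space P. T i \<omega> = T j \<omega>} = 0"
  shows "AE \<omega> in P. inj_on (\<lambda>i. T i \<omega>) C"
proof -
  interpret prob_space P by fact
  have "AE \<omega> in P. i \<noteq> j \<longrightarrow> T i \<omega> \<noteq> T j \<omega>" if "i \<in> C" "j \<in> C" for i j
  proof (cases "i = j")
    case False
    have [measurable]: "T i \<in> borel_measurable P" "T j \<in> borel_measurable P"
      using assms(3) that by auto
    have "{\<omega> \<in> space P. T i \<omega> = T j \<omega>} \<in> events" by measurable
    then have "AE \<omega> in P. \<omega> \<notin> {\<omega> \<in> space P. T i \<omega> = T j \<omega>}"
      using assms(4)[OF that False] prob_eq_0 by blast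
    then show ?thesis using AE_space by eventually_elim auto
  qed simp
  then have "AE \<omega> in P. \<forall>i\<in>C. \<forall>j\<in>C. i \<noteq> j \<longrightarrow> T i \<omega> \<noteq> T j \<omega>"
    using assms(2) by (simp add: AE_finite_all)
  then show ?thesis by eventually_elim (auto simp: inj_on_def)
qed

theorem theorem1:
  fixes n :: nat and C :: "nat set" and \<phi> :: "nat set \<Rightarrow> real"
    and P :: "'a measure" and T :: "nat \<Rightarrow> 'a \<Rightarrow> real"
    and M :: "nat set" and k :: nat
  assumes C_eq: "C = {1..n}"
    and semicoherent: "semicoherent C \<phi>"
    and prob: "prob_space P"
    and rv: "\<And>i. i \<in> C \<Longrightarrow> T i \<in> borel_measurable P"
    and nonneg: "\<And>i \<omega>. i \<in> C \<Longrightarrow> \<omega> \<in> space P \<Longrightarrow> 0 \<le> T i \<omega>"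
    and no_ties: "\<And>i j. i \<in> C \<Longrightarrow> j \<in> C \<Longrightarrow> i \<noteq> j \<Longrightarrow>
                    measure P {\<omega> \<in> space P. T i \<omega> = T j \<omega>} = 0"
    and M: "M \<subseteq> C" "M \<noteq> {}"
    and k: "k \<in> {1..card M}"
  shows "measure P {\<omega> \<in> space P. system_lifetime C \<phi> T \<omega> = order_stat T M k \<omega>}
           = (\<Sum>A | A \<subseteq> C \<and> card (M - A) = k.
                \<Sum>j\<in>M - A. rel_quality P C T j A * Delta j \<phi> A)
       \<and> (\<Sum>A | A \<subseteq> C \<and> card (M - A) = k.
                \<Sum>j\<in>M - A. rel_quality P C T j A * Delta j \<phi> A)
           = (\<Sum>j\<in>M. \<Sum>A | A \<subseteq> C - {j} \<and> card (M - A) = k.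
                rel_quality P C T j A * Delta j \<phi> A)"
proof
  interpret prob_space P by (rule prob)
  have finC: "finite C" and finM: "finite M"
    using C_eq M(1) by (auto intro: finite_subset)
  \<comment> \<open>\<open>?Q j A\<close> is the event that \<open>A\<close> is the set of survivors of \<open>j\<close>.\<close>
  let ?E = "{\<omega> \<in> space P. system_lifetime C \<phi> T \<omega> = order_stat T M k \<omega>}"
  let ?Q = "\<lambda>j A. {\<omega> \<in> space P. A = {i \<in> C. T j \<omega> < T i \<omega>}}"
  let ?\<A> = "\<lambda>j. {A. A \<subseteq> C - {j} \<and> card (M - A) = k}"
  have [measurable]: "system_lifetime C \<phi> T \<in> borel_measurable P"
    by (rule borel_measurable_system_lifetime[OF semicoherent finC rv])
  have [measurable]: "order_stat T M k \<in> borel_measurable P"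
    using M(1) by (intro borel_measurable_order_stat[OF finM k] rv) auto
  have E: "?E \<in> events" by measurable
  have Q: "?Q j A \<in> events" if "j \<in> M" "A \<in> ?\<A> j" for j A
    using that M(1) by (intro sets_survivors_eq finC rv) auto
  have integrable_Q: "integrable P (\<lambda>\<omega>. indicat_real (?Q j A) \<omega> * Delta j \<phi> A)"
    if "j \<in> M" "A \<in> ?\<A> j" for j A
    using Q[OF that] by (simp add: less_top[symmetric])
  have inj: "AE \<omega> in P. inj_on (\<lambda>i. T i \<omega>) C"
    by (rule AE_inj_on_of_no_ties[OF prob finC rv no_ties])
  have "AE \<omega> in P. indicat_real ?E \<omega>
      = (\<Sum>j\<in>M. \<Sum>A\<in>?\<A> j. indicat_real (?Q j A) \<omega> * Delta j \<phi> A)"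
    using inj AE_space
  proof eventually_elim
    case (elim \<omega>)
    then show ?case
      using indicator_lifetime_eq_order_stat[where T = T, OF semicoherent finC M(1) k elim(1)]
      by (simp add: indicator_def of_bool_def cong: if_cong)
  qed
  then have "(\<integral>\<omega>. indicat_real ?E \<omega> \<partial>P)
      = (\<integral>\<omega>. (\<Sum>j\<in>M. \<Sum>A\<in>?\<A> j. indicat_real (?Q j A) \<omega> * Delta j \<phi> A) \<partial>P)"
    using E Q by (intro integral_cong_AE borel_measurable_sum borel_measurable_times) auto
  also have "\<dots> = (\<Sum>j\<in>M. \<integral>\<omega>. (\<Sum>A\<in>?\<A> j. indicat_real (?Q j A) \<omega> * Delta j \<phi> A) \<partial>P)"
    by (intro Bochner_Integration.integral_sum Bochner_Integration.integrable_sum integrable_Q)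
  also have "\<dots> = (\<Sum>j\<in>M. \<Sum>A\<in>?\<A> j. \<integral>\<omega>. indicat_real (?Q j A) \<omega> * Delta j \<phi> A \<partial>P)"
    by (intro sum.cong refl Bochner_Integration.integral_sum integrable_Q)
  also have "\<dots> = (\<Sum>j\<in>M. \<Sum>A\<in>?\<A> j. prob (?Q j A) * Delta j \<phi> A)"
    using Q by (intro sum.cong refl) (simp del: mem_Collect_eq)
  also have "\<dots> = (\<Sum>j\<in>M. \<Sum>A\<in>?\<A> j. rel_quality P C T j A * Delta j \<phi> A)"
    using M(1) finC
    by (intro sum.cong refl arg_cong2[where f = "(*)"] rel_quality_eq_measure_survivors[symmetric])
      auto
  finally have expectation: "prob ?E
      = (\<Sum>j\<in>M. \<Sum>A\<in>?\<A> j. rel_quality P C T j A * Delta j \<phi> A)"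
    using E by simp
  show swap: "(\<Sum>A | A \<subseteq> C \<and> card (M - A) = k. \<Sum>j\<in>M - A. rel_quality P C T j A * Delta j \<phi> A)
      = (\<Sum>j\<in>M. \<Sum>A\<in>?\<A> j. rel_quality P C T j A * Delta j \<phi> A)"
  proof -
    let ?f = "\<lambda>j A. rel_quality P C T j A * Delta j \<phi> A"
    let ?\<B> = "{A. A \<subseteq> C \<and> card (M - A) = k}"
    have "(\<Sum>A\<in>?\<B>. \<Sum>j\<in>{j \<in> M. j \<notin> A}. ?f j A) = (\<Sum>j\<in>M. \<Sum>A\<in>{A \<in> ?\<B>. j \<notin> A}. ?f j A)"
      using finC finM by (intro sum.swap_restrict) auto
    moreover have "{j \<in> M. j \<notin> A} = M - A" for A by auto
    moreover have "{A \<in> ?\<B>. j \<notin> A} = ?\<A> j" for j by auto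
    ultimately show ?thesis by simp
  qed
  show "prob ?E
      = (\<Sum>A | A \<subseteq> C \<and> card (M - A) = k. \<Sum>j\<in>M - A. rel_quality P C T j A * Delta j \<phi> A)"
    using expectation swap by simp
qed

end
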